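(* Let $q$ be a prime power, let $n\ge 2$, and let $G$ be a finite undirected multigraph (loops and parallel edges allowed) on the vertex set $\{p_1,\dots,p_n\}$ that is the graph representation of a coding scheme over $GF(q)$. Let $H$ be a subgraph of $G$ obtained from $G$ by deleting some edges, keeping all $n$ vertices. Then $H$ is decodable if and only if exactly one of the following holds: (1) $q$ is even and every connected component of $H$ contains a loop; (2) $q$ is odd and every connected component of $H$ contains a cycle of odd length.
   Context: Packets $p_1,\dots,p_n\in GF(q)^\ell$ are to be sent; a coding scheme is a list of encodings, each of which is either $p_j$ or $p_j+p_k$ with $j\neq k$. Its graph representation $G$ has vertices $p_1,\dots,p_n$, one edge joining $p_j$ and $p_k$ for each encoding $p_j+p_k$, and one loop at $p_j$ for each encoding $p_j$ (edges are labelled so that all are distinguishable). A subgraph $H$ (with vertex set $\{p_1,\dots,p_n\}$ and edge multiset contained in that of $G$) is decodable if the linear system formed by the encodings corresponding to the edges of $H$ can be solved for unique $p_1,\dots,p_n$, i.e. the map $(p_1,\dots,p_n)\mapsto(\text{encodings of the edges of }H)$ on $(GF(q)^\ell)^n$ is injective; otherwise $H$ is undecodable. A loop is a cycle of length $1$ and two parallel edges form a cycle of length $2$. An isolated vertex forms a connected component on its own. *)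

theory Defs
  imports "HOL-Analysis.Finite_Cartesian_Product" "HOL-Library.FuncSet"
    "HOL-Number_Theory.Number_Theory"
begin

section \<open>Finite undirected multigraphs with labelled edges\<close>

text \<open>
  The map \<open>ends\<close> gives the set of end points of an edge: \<open>{v}\<close> for a loop at \<open>v\<close>,
  and \<open>{u, v}\<close> with \<open>u \<noteq> v\<close> for an ordinary edge. Its values outside \<open>edges\<close> are irrelevant.
\<close>

record ('v, 'e) multigraph =
  verts :: "'v set"
  edges :: "'e set"
  ends :: "'e \<Rightarrow> 'v set"

definition spanning_subgraph :: "('v, 'e) multigraph \<Rightarrow> ('v, 'e) multigraph \<Rightarrow> bool" where
  "spanning_subgraph H G \<longleftrightarrow>
     verts H = verts G \<and> edges H \<subseteq> edges G \<and> (\<forall>e\<in>edges H. ends H e = ends G e)"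

definition induced_subgraph :: "('v, 'e) multigraph \<Rightarrow> 'v set \<Rightarrow> ('v, 'e) multigraph" where
  "induced_subgraph H C =
     \<lparr>verts = C, edges = {e \<in> edges H. ends H e \<subseteq> C}, ends = ends H\<rparr>"

definition adjacency :: "('v, 'e) multigraph \<Rightarrow> ('v \<times> 'v) set" where
  "adjacency H = {(u, v). \<exists>e\<in>edges H. ends H e = {u, v}}"

definition connectivity :: "('v, 'e) multigraph \<Rightarrow> ('v \<times> 'v) set" where
  "connectivity H = {(u, v). u \<in> verts H \<and> v \<in> verts H \<and> (u, v) \<in> (adjacency H)\<^sup>*}"

definition components :: "('v, 'e) multigraph \<Rightarrow> ('v, 'e) multigraph set" where
  "components H = induced_subgraph H ` (verts H // connectivity H)"

definition contains_loop :: "('v, 'e) multigraph \<Rightarrow> bool" where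
  "contains_loop K \<longleftrightarrow> (\<exists>e\<in>edges K. \<exists>v\<in>verts K. ends K e = {v})"

text \<open>
  A cycle of length \<open>k \<ge> 1\<close> consists of \<open>k\<close> distinct vertices and \<open>k\<close> distinct edges, the
  \<open>i\<close>-th edge joining the \<open>i\<close>-th vertex to its cyclic successor. For \<open>k = 1\<close> this is a loop; for
  \<open>k = 2\<close> the distinctness of the edges makes it a pair of parallel edges.
\<close>

definition is_cycle :: "('v, 'e) multigraph \<Rightarrow> 'v list \<Rightarrow> 'e list \<Rightarrow> bool" where
  "is_cycle K vs es \<longleftrightarrow>
     vs \<noteq> [] \<and> length es = length vs \<and> distinct vs \<and> distinct es \<and>
     set vs \<subseteq> verts K \<and> set es \<subseteq> edges K \<and>
     (\<forall>i<length vs. ends K (es ! i) = {vs ! i, vs ! (Suc i mod length vs)})"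

definition contains_odd_cycle :: "('v, 'e) multigraph \<Rightarrow> bool" where
  "contains_odd_cycle K \<longleftrightarrow> (\<exists>vs es. is_cycle K vs es \<and> odd (length es))"


section \<open>Coding schemes\<close>

text \<open>Packets are indexed by \<open>1, \<dots>, n\<close>; the vertex \<open>p\<^sub>j\<close> is represented by its index \<open>j\<close>.\<close>

datatype encoding = Single nat | Pair_Sum nat nat

fun valid_encoding :: "nat \<Rightarrow> encoding \<Rightarrow> bool" where
  "valid_encoding n (Single j) \<longleftrightarrow> j \<in> {1..n}"
| "valid_encoding n (Pair_Sum j k) \<longleftrightarrow> j \<in> {1..n} \<and> k \<in> {1..n} \<and> j \<noteq> k"

definition coding_scheme :: "nat \<Rightarrow> encoding list \<Rightarrow> bool" where
  "coding_scheme n cs \<longleftrightarrow> (\<forall>c\<in>set cs. valid_encoding n c)"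

fun encode :: "encoding \<Rightarrow> (nat \<Rightarrow> 'p::plus) \<Rightarrow> 'p" where
  "encode (Single j) p = p j"
| "encode (Pair_Sum j k) p = p j + p k"

fun encoding_ends :: "encoding \<Rightarrow> nat set" where
  "encoding_ends (Single j) = {j}"
| "encoding_ends (Pair_Sum j k) = {j, k}"

text \<open>Edges are labelled by the positions in the list of encodings.\<close>

definition graph_representation :: "nat \<Rightarrow> encoding list \<Rightarrow> (nat, nat) multigraph" where
  "graph_representation n cs =
     \<lparr>verts = {1..n}, edges = {..<length cs}, ends = (\<lambda>i. encoding_ends (cs ! i))\<rparr>"

text \<open>
  The type argument is the space of packets. Packet families and families of encodings are
  \<open>undefined\<close> outside \<open>verts H\<close> and \<open>edges H\<close> respectively, so that they can be compared by \<open>=\<close>.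
\<close>

definition decodable :: "'p::plus itself \<Rightarrow> encoding list \<Rightarrow> (nat, nat) multigraph \<Rightarrow> bool" where
  "decodable _ cs H \<longleftrightarrow>
     inj_on (\<lambda>p. \<lambda>i\<in>edges H. encode (cs ! i) p) (verts H \<rightarrow>\<^sub>E (UNIV :: 'p set))"

end

theory Submission
  imports Defs
begin

text \<open>
  Two packet families have the same encodings iff their difference \<open>d\<close> is annihilated by all
  encodings: \<open>d\<close> vanishes at loops and changes sign along every edge. In characteristic 2 such a
  \<open>d\<close> is constant on components, and the constant is forced to be 0 exactly by a loop. In odd
  characteristic an odd cycle forces \<open>d = - d\<close>, hence \<open>d = 0\<close>, while a component without odd cycles
  is bipartite and carries the nonzero solution \<open>\<plusminus>c\<close>.
\<close>

section \<open>Connectivity and bipartiteness of multigraphs\<close>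

lemma sym_adjacency: "sym (adjacency H)"
  by (auto simp: sym_def adjacency_def insert_commute)

lemma equiv_connectivity: "equiv (verts H) (connectivity H)"
proof (rule equivI)
  have "sym ((adjacency H)\<^sup>*)"
    using sym_adjacency by (rule sym_rtrancl)
  then show "sym (connectivity H)"
    by (auto simp: connectivity_def sym_def)
  show "trans (connectivity H)"
    by (auto simp: connectivity_def trans_def)
qed (auto simp: connectivity_def refl_on_def)

lemma component_closed:
  assumes "C \<in> verts H // connectivity H"
    and "e \<in> edges H" and "ends H e = {u, v}" and "u \<in> C" and "v \<in> verts H"
  shows "v \<in> C"
proof -
  have "u \<in> verts H"
    using assms(1,4) equiv_connectivity[of H] by (metis in_quotient_imp_subset subsetD)
  then have "(u, v) \<in> connectivity H"
    using assms(2,3,5) by (auto simp: connectivity_def adjacency_def)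
  then show ?thesis
    using assms(1,4) equiv_connectivity[of H] by (metis in_quotient_imp_closed)
qed

section \<open>Simple paths in multigraphs\<close>

text \<open>Induction along the reachability chain: a new vertex is appended together with its edge,
  while a vertex already visited cuts the path back to that visit. The indexed form matches
  \<open>is_cycle\<close>, so that one more edge can close the path.\<close>

lemma simple_path_exists:
  assumes "(u, v) \<in> (adjacency K)\<^sup>*"
  obtains vs es where "length vs = Suc (length es)" "distinct vs" "vs ! 0 = u"
    "vs ! length es = v" "set es \<subseteq> edges K"
    "\<And>i. i < length es \<Longrightarrow> ends K (es ! i) = {vs ! i, vs ! Suc i}"
proof -
  have "\<exists>vs es. length vs = Suc (length es) \<and> distinct vs \<and> vs ! 0 = u \<and>
    vs ! length es = v \<and> set es \<subseteq> edges K \<and>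
    (\<forall>i<length es. ends K (es ! i) = {vs ! i, vs ! Suc i})"
    using assms
  proof (induction rule: rtrancl_induct)
    case base
    show ?case
      by (rule exI[of _ "[u]"], rule exI[of _ "[]"]) simp
  next
    case (step y z)
    from step.IH obtain vs es where p: "length vs = Suc (length es)" "distinct vs" "vs ! 0 = u"
      "vs ! length es = y" "set es \<subseteq> edges K"
      "\<forall>i<length es. ends K (es ! i) = {vs ! i, vs ! Suc i}"
      by blast
    from step.hyps(2) obtain e where e: "e \<in> edges K" "ends K e = {y, z}"
      by (auto simp: adjacency_def)
    show ?case
    proof (cases "z \<in> set vs")
      case True
      then obtain i where i: "i < length vs" "vs ! i = z"
        by (auto simp: in_set_conv_nth)
      show ?thesis
        using p i
        by (intro exI[of _ "take (Suc i) vs"] exI[of _ "take i es"])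
          (auto dest: in_set_takeD)
    next
      case False
      show ?thesis
        using p e False
        by (intro exI[of _ "vs @ [z]"] exI[of _ "es @ [e]"])
          (auto simp: nth_append less_Suc_eq)
    qed
  qed
  then show thesis
    using that by blast
qed

text \<open>An edge repeated at positions \<open>i < j\<close> would put \<open>vs ! i\<close> among
  the later vertices \<open>vs ! j\<close> and \<open>vs ! Suc j\<close>.\<close>

lemma simple_path_distinct_edges:
  assumes "length vs = Suc (length es)" "distinct vs"
    and "\<And>i. i < length es \<Longrightarrow> ends K (es ! i) = {vs ! i, vs ! Suc i}"
  shows "distinct es"
proof -
  have "es ! i \<noteq> es ! j" if "i < j" "j < length es" for i j
  proof
    assume "es ! i = es ! j"
    then have "vs ! i \<in> {vs ! j, vs ! Suc j}"
      using assms(3)[of i] assms(3)[of j] that by auto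
    then show False
      using assms(1,2) that by (auto simp: nth_eq_iff_index_eq)
  qed
  then show ?thesis
    by (metis distinct_conv_nth nat_neq_iff)
qed

text \<open>
  Edges are added one at a time. If the ends of the new edge have the same colour, they are not yet
  connected, as an alternating path between them would have even length and close up to an odd
  cycle; so the colours can be flipped on the component of one end.
\<close>

lemma two_coloring_exists:
  assumes "finite E"
    and "\<And>e. e \<in> E \<Longrightarrow> \<exists>u\<in>verts K. \<exists>v\<in>verts K. ends K e = {u, v}"
    and "\<not> contains_odd_cycle (K\<lparr>edges := E\<rparr>)"
  shows "\<exists>f :: 'v \<Rightarrow> bool. \<forall>e\<in>E. \<forall>u v. ends (K :: ('v, 'e) multigraph) e = {u, v} \<longrightarrow> f u \<noteq> f v"
  using assms
proof (induction E rule: finite_induct)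
  case empty
  then show ?case by simp
next
  case (insert e E)
  let ?K = "K\<lparr>edges := E\<rparr>"
  have "\<not> contains_odd_cycle ?K"
    using insert.prems(2) by (auto simp: contains_odd_cycle_def is_cycle_def subset_insertI2)
  then obtain f :: "'v \<Rightarrow> bool"
    where f: "\<And>e u v. e \<in> E \<Longrightarrow> ends K e = {u, v} \<Longrightarrow> f u \<noteq> f v"
    using insert.IH insert.prems(1) by (metis insertCI)
  from insert.prems(1) obtain u v
    where uv: "u \<in> verts K" "v \<in> verts K" "ends K e = {u, v}"
    by blast
  show ?case
  proof (cases "f u = f v")
    case False
    then have "f x \<noteq> f y" if "ends K e = {x, y}" for x y
      using that uv by (auto simp: doubleton_eq_iff)
    then show ?thesis
      using f by (intro exI[of _ f]) blast
  next
    case same: True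
    have "(u, v) \<notin> (adjacency ?K)\<^sup>*"
    proof
      assume "(u, v) \<in> (adjacency ?K)\<^sup>*"
      then obtain vs es where p: "length vs = Suc (length es)" "distinct vs" "vs ! 0 = u"
        "vs ! length es = v" "set es \<subseteq> E"
        "\<And>i. i < length es \<Longrightarrow> ends K (es ! i) = {vs ! i, vs ! Suc i}"
        by (rule simple_path_exists) auto
      \<comment> \<open>Colours alternate along the path, so equal colours at its two ends make its
        length even.\<close>
      have alternate: "i \<le> length es \<Longrightarrow> f (vs ! i) = (f u = even i)" for i
      proof (induction i)
        case (Suc i)
        then have i: "i < length es"
          by simp
        then have "es ! i \<in> E"
          using p(5) nth_mem by blast
        then have "f (vs ! i) \<noteq> f (vs ! Suc i)"
          using f p(6)[OF i] by blast
        then show ?case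
          using Suc.IH i by auto
      qed (use p in simp)
      have "even (length es)"
        using alternate[of "length es"] p(4) same by auto
      have in_verts: "vs ! i \<in> verts K" if "i \<le> length es" for i
      proof (cases i)
        case 0
        then show ?thesis using p uv by simp
      next
        case (Suc j)
        then have "es ! j \<in> E"
          using p(5) that by auto
        then have "ends K (es ! j) \<subseteq> verts K"
          using insert.prems(1) by fastforce
        then show ?thesis
          using p(6)[of j] Suc that by simp
      qed
      \<comment> \<open>The edge \<open>e\<close> leads from \<open>v\<close> back to
        \<open>u\<close>: it has index \<open>length es\<close>, whose cyclic successor is 0. If
        \<open>u = v\<close>, the path is trivial and \<open>e\<close> is a loop.\<close>
      have "is_cycle (K\<lparr>edges := insert e E\<rparr>) vs (es @ [e])"
        unfolding is_cycle_def
      proof (intro conjI allI impI)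
        show "distinct (es @ [e])"
          using simple_path_distinct_edges[OF p(1,2,6)] p(5) insert.hyps(2) by auto
        show "set vs \<subseteq> verts (K\<lparr>edges := insert e E\<rparr>)"
          using in_verts p(1) by (auto simp: in_set_conv_nth)
        fix i assume "i < length vs"
        then show "ends (K\<lparr>edges := insert e E\<rparr>) ((es @ [e]) ! i) =
            {vs ! i, vs ! (Suc i mod length vs)}"
          using p uv by (cases "i = length es") (auto simp: nth_append)
      qed (use p in auto)
      then show False
        using insert.prems(2) \<open>even (length es)\<close> unfolding contains_odd_cycle_def by fastforce
    qed
    \<comment> \<open>No edge of \<open>E\<close> leaves \<open>R\<close>, so flipping
      \<open>f\<close> on \<open>R\<close> keeps the colouring proper on \<open>E\<close>; it
      separates the ends of \<open>e\<close>, as only \<open>u\<close> lies in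
      \<open>R\<close>.\<close>
    define R where "R = {x. (u, x) \<in> (adjacency ?K)\<^sup>*}"
    have R_closed: "x \<in> R \<longleftrightarrow> y \<in> R" if "e' \<in> E" "ends K e' = {x, y}" for e' x y
    proof -
      have "(x, y) \<in> adjacency ?K" "(y, x) \<in> adjacency ?K"
        using that by (auto simp: adjacency_def insert_commute)
      then show ?thesis
        unfolding R_def by (auto intro: rtrancl_into_rtrancl)
    qed
    define g where "g x = (if x \<in> R then \<not> f x else f x)" for x
    have "u \<in> R" "v \<notin> R"
      using \<open>(u, v) \<notin> _\<close> by (auto simp: R_def)
    then have "g u \<noteq> g v"
      using same by (simp add: g_def)
    then have "g x \<noteq> g y" if "ends K e = {x, y}" for x y
      using that uv by (auto simp: doubleton_eq_iff)
    moreover have "g x \<noteq> g y" if "e' \<in> E" "ends K e' = {x, y}" for e' x y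
      using f[OF that] R_closed[OF that] by (auto simp: g_def)
    ultimately show ?thesis
      by (intro exI[of _ g]) blast
  qed
qed

section \<open>Decodability\<close>

locale coding_subgraph =
  fixes n :: nat and cs :: "encoding list" and H :: "(nat, nat) multigraph"
  assumes scheme: "coding_scheme n cs"
    and spanning: "spanning_subgraph H (graph_representation n cs)"
begin

lemma finite_edges: "finite (edges H)"
  using spanning
  by (auto simp: spanning_subgraph_def graph_representation_def intro: finite_subset)

lemma edge_cases:
  assumes "e \<in> edges H"
  obtains (loop) j where "j \<in> verts H" "cs ! e = Single j" "ends H e = {j}"
    | (link) j k where "j \<in> verts H" "k \<in> verts H" "j \<noteq> k" "cs ! e = Pair_Sum j k"
        "ends H e = {j, k}"
proof -
  have "valid_encoding n (cs ! e)" "ends H e = encoding_ends (cs ! e)" "verts H = {1..n}"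
    using assms scheme spanning
    by (auto simp: spanning_subgraph_def graph_representation_def coding_scheme_def)
  then show thesis
    using that by (cases "cs ! e") auto
qed

lemma edge_ends:
  assumes "e \<in> edges H"
  shows "\<exists>u\<in>verts H. \<exists>v\<in>verts H. ends H e = {u, v}"
  using assms by (rule edge_cases) auto

section \<open>Kernel of the encoding map\<close>

definition annihilated :: "(nat \<Rightarrow> 'p::ab_group_add) \<Rightarrow> bool" where
  "annihilated d \<longleftrightarrow> (\<forall>e\<in>edges H. encode (cs ! e) d = 0)"

text \<open>One relation covers both kinds of edge: at a loop \<open>u = v\<close> and already
  \<open>d u = 0\<close>. Arguments along paths and cycles thus need no case distinction.\<close>

lemma annihilated_sum:
  assumes "annihilated d" and "e \<in> edges H" and "ends H e = {u, v}"
  shows "d u + d v = 0"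
  using assms(2)
proof (cases rule: edge_cases)
  case (loop j)
  then show ?thesis
    using assms by (auto simp: annihilated_def)
next
  case (link j k)
  then have "d j + d k = 0"
    using assms by (auto simp: annihilated_def)
  then show ?thesis
    using assms(3) link(5) by (auto simp: doubleton_eq_iff add.commute)
qed

text \<open>An additive map is injective iff its kernel is trivial: the difference of two families
  with equal encodings lies in the kernel.\<close>

lemma decodable_iff_annihilated:
  "decodable TYPE('p::ab_group_add) cs H \<longleftrightarrow>
    (\<forall>d :: nat \<Rightarrow> 'p. annihilated d \<longrightarrow> (\<forall>v\<in>verts H. d v = 0))"
proof
  assume dec: "decodable TYPE('p) cs H"
  show "\<forall>d :: nat \<Rightarrow> 'p. annihilated d \<longrightarrow> (\<forall>v\<in>verts H. d v = 0)"
  proof (intro allI impI ballI)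
    fix d :: "nat \<Rightarrow> 'p" and v
    assume d: "annihilated d" and v: "v \<in> verts H"
    \<comment> \<open>Decodability compares only families that are \<open>undefined\<close> outside
      \<open>verts H\<close>, so \<open>d\<close> and the zero family are restricted first; edges
      read values at vertices only.\<close>
    have "encode (cs ! e) (restrict d (verts H)) = encode (cs ! e) (\<lambda>v\<in>verts H. 0)"
      if "e \<in> edges H" for e
      using that
    proof (cases rule: edge_cases)
      case (loop j)
      then show ?thesis
        using d that by (auto simp: annihilated_def)
    next
      case (link j k)
      then show ?thesis
        using d that by (auto simp: annihilated_def)
    qed
    then have "(\<lambda>e\<in>edges H. encode (cs ! e) (restrict d (verts H))) =
        (\<lambda>e\<in>edges H. encode (cs ! e) (\<lambda>v\<in>verts H. 0))"
      by (intro restrict_ext)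
    then have "restrict d (verts H) = (\<lambda>v\<in>verts H. 0)"
      by (rule inj_onD[OF dec[unfolded decodable_def]]) auto
    then show "d v = 0"
      using v by (metis restrict_apply')
  qed
next
  assume kernel: "\<forall>d :: nat \<Rightarrow> 'p. annihilated d \<longrightarrow> (\<forall>v\<in>verts H. d v = 0)"
  show "decodable TYPE('p) cs H"
    unfolding decodable_def
  proof (rule inj_onI)
    fix p p' :: "nat \<Rightarrow> 'p"
    assume p: "p \<in> verts H \<rightarrow>\<^sub>E UNIV" and p': "p' \<in> verts H \<rightarrow>\<^sub>E UNIV"
      and same: "(\<lambda>e\<in>edges H. encode (cs ! e) p) = (\<lambda>e\<in>edges H. encode (cs ! e) p')"
    have linear: "encode c (\<lambda>v. p v - p' v) = encode c p - encode c p'" for c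
      by (cases c) auto
    have "encode (cs ! e) p = encode (cs ! e) p'" if "e \<in> edges H" for e
      using fun_cong[OF same, of e] that by simp
    then have "annihilated (\<lambda>v. p v - p' v)"
      by (simp add: annihilated_def linear)
    then have "p v = p' v" if "v \<in> verts H" for v
      using kernel that by fastforce
    then show "p = p'"
      using p p' by (intro PiE_ext) auto
  qed
qed

section \<open>Sufficiency: zeros of kernel elements\<close>

lemma annihilated_zero_component:
  assumes "annihilated d" and "(u, v) \<in> (adjacency H)\<^sup>*" and "d u = 0"
  shows "d v = 0"
  using assms(2)
proof (induction rule: rtrancl_induct)
  case (step y z)
  then show ?case
    using annihilated_sum[OF assms(1)] by (fastforce simp: adjacency_def)
qed (rule assms(3))

text \<open>A zero spreads along edges, since \<open>d y + d z = 0\<close>, so one zero per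
  component forces \<open>d\<close> to vanish on all vertices. Both sufficiency proofs then only
  have to find such a zero.\<close>

lemma decodable_if_zero_in_components:
  assumes "\<And>d :: nat \<Rightarrow> 'p::ab_group_add. \<And>K. annihilated d \<Longrightarrow> K \<in> components H \<Longrightarrow>
    \<exists>u\<in>verts K. d u = 0"
  shows "decodable TYPE('p) cs H"
  unfolding decodable_iff_annihilated
proof (intro allI impI ballI)
  fix d :: "nat \<Rightarrow> 'p" and v
  assume d: "annihilated d" and v: "v \<in> verts H"
  let ?C = "connectivity H `` {v}"
  have "induced_subgraph H ?C \<in> components H"
    using v by (auto simp: components_def intro: quotientI)
  then obtain u where u: "u \<in> ?C" "d u = 0"
    using assms[OF d] by (fastforce simp: induced_subgraph_def)
  then have "(u, v) \<in> (adjacency H)\<^sup>*"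
    using sym_rtrancl[OF sym_adjacency[of H]] by (auto simp: connectivity_def dest: symD)
  then show "d v = 0"
    using annihilated_zero_component d u by blast
qed

lemma zero_at_loop:
  assumes "annihilated d" and "K \<in> components H" and "contains_loop K"
  shows "\<exists>u\<in>verts K. d u = 0"
proof -
  from assms(2,3) obtain e u where e: "e \<in> edges H" "u \<in> verts K" "ends H e = {u}"
    by (auto simp: contains_loop_def components_def induced_subgraph_def)
  from e(1) have "cs ! e = Single u"
    using e(3) by (cases rule: edge_cases) auto
  then have "d u = 0"
    using assms(1) e(1) unfolding annihilated_def by (metis encode.simps(1))
  then show ?thesis
    using e(2) by blast
qed

text \<open>Signs alternate around the cycle. Odd length gives the last vertex the sign of the
  first, so the closing edge yields \<open>x + x = 0\<close> for the value \<open>x\<close> there;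
  length 1 is included.\<close>

lemma zero_on_odd_cycle:
  fixes d :: "nat \<Rightarrow> 'p::ab_group_add"
  assumes no_torsion: "\<And>x :: 'p. x + x = 0 \<Longrightarrow> x = 0"
    and "annihilated d" and "K \<in> components H" and "contains_odd_cycle K"
  shows "\<exists>u\<in>verts K. d u = 0"
proof -
  from assms(4) obtain vs es where cyc: "is_cycle K vs es" and odd: "odd (length es)"
    by (auto simp: contains_odd_cycle_def)
  then have len: "length es = length vs" "vs \<noteq> []" and "set vs \<subseteq> verts K"
    by (auto simp: is_cycle_def)
  have sum: "d (vs ! i) + d (vs ! (Suc i mod length vs)) = 0" if "i < length vs" for i
  proof -
    have "es ! i \<in> edges K" "ends K (es ! i) = {vs ! i, vs ! (Suc i mod length vs)}"
      using cyc that by (auto simp: is_cycle_def)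
    then show ?thesis
      using assms(2,3) annihilated_sum
      by (auto simp: components_def induced_subgraph_def)
  qed
  have alternate: "d (vs ! i) = (if even i then d (vs ! 0) else - d (vs ! 0))"
    if "i < length vs" for i
    using that
  proof (induction i)
    case (Suc i)
    have "d (vs ! i) + d (vs ! Suc i) = 0"
      using sum[of i] Suc.prems by simp
    then show ?case
      using Suc by (auto simp: add_eq_0_iff split: if_splits)
  qed simp
  have "d (vs ! (length vs - 1)) = d (vs ! 0)"
    using alternate[of "length vs - 1"] odd len by auto
  then have "d (vs ! 0) + d (vs ! 0) = 0"
    using sum[of "length vs - 1"] len by simp
  then have "d (vs ! 0) = 0"
    by (rule no_torsion)
  then show ?thesis
    using \<open>set vs \<subseteq> verts K\<close> len(2) by (metis length_greater_0_conv nth_mem subsetD)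
qed

section \<open>Necessity: solutions supported on one component\<close>

text \<open>Extending \<open>d\<close> by 0 outside \<open>C\<close> gives a nonzero kernel element,
  because no edge leaves \<open>C\<close>. Loops are excluded separately: there \<open>sum\<close>
  yields only \<open>d u + d u = 0\<close>, whereas the kernel requires
  \<open>d u = 0\<close>.\<close>

lemma not_decodable_if_component_solution:
  fixes d :: "nat \<Rightarrow> 'p::ab_group_add"
  assumes C: "C \<in> verts H // connectivity H"
    and no_loop: "\<not> contains_loop (induced_subgraph H C)"
    and sum: "\<And>e u v. e \<in> edges H \<Longrightarrow> ends H e = {u, v} \<Longrightarrow> u \<in> C \<Longrightarrow> v \<in> C \<Longrightarrow> d u + d v = 0"
    and nonzero: "\<And>v. v \<in> C \<Longrightarrow> d v \<noteq> 0"
  shows "\<not> decodable TYPE('p) cs H"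
proof -
  let ?d = "\<lambda>v. if v \<in> C then d v else 0"
  have "encode (cs ! e) ?d = 0" if e: "e \<in> edges H" for e
    using e
  proof (cases rule: edge_cases)
    case (loop j)
    then have "j \<notin> C"
      using no_loop e by (auto simp: contains_loop_def induced_subgraph_def)
    then show ?thesis
      using loop by simp
  next
    case (link j k)
    then have "j \<in> C \<longleftrightarrow> k \<in> C"
      using component_closed[OF C e] by (metis insert_commute)
    then show ?thesis
      using link sum[OF e] by auto
  qed
  then have "annihilated ?d"
    by (simp add: annihilated_def)
  moreover obtain v where "v \<in> C" "v \<in> verts H"
    using C equiv_connectivity[of H] by 
    (metis in_quotient_imp_non_empty in_quotient_imp_subset ex_in_conv subsetD)
  then have "\<exists>v\<in>verts H. ?d v \<noteq> 0"
    using nonzero by auto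
  ultimately show ?thesis
    unfolding decodable_iff_annihilated by blast
qed

lemma decodable_iff_loops:
  assumes "\<And>x :: 'p::ab_group_add. x + x = 0" and "(c :: 'p) \<noteq> 0"
  shows "decodable TYPE('p) cs H \<longleftrightarrow> (\<forall>K\<in>components H. contains_loop K)"
proof
  assume dec: "decodable TYPE('p) cs H"
  show "\<forall>K\<in>components H. contains_loop K"
  proof (rule ballI, rule ccontr)
    fix K assume "K \<in> components H" "\<not> contains_loop K"
    then obtain C where "C \<in> verts H // connectivity H"
      "\<not> contains_loop (induced_subgraph H C)"
      by (auto simp: components_def)
    \<comment> \<open>The constant family \<open>c\<close> satisfies every sum condition because
      \<open>c + c = 0\<close>.\<close>
    then show False
      using not_decodable_if_component_solution[of C "\<lambda>_. c"] assms dec by blast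
  qed
next
  assume "\<forall>K\<in>components H. contains_loop K"
  then show "decodable TYPE('p) cs H"
    using zero_at_loop decodable_if_zero_in_components by blast
qed

lemma decodable_iff_odd_cycles:
  assumes "\<And>x :: 'p::ab_group_add. x + x = 0 \<Longrightarrow> x = 0" and "(c :: 'p) \<noteq> 0"
  shows "decodable TYPE('p) cs H \<longleftrightarrow> (\<forall>K\<in>components H. contains_odd_cycle K)"
proof
  assume dec: "decodable TYPE('p) cs H"
  show "\<forall>K\<in>components H. contains_odd_cycle K"
  proof (rule ballI, rule ccontr)
    fix K assume "K \<in> components H" and no_odd: "\<not> contains_odd_cycle K"
    then obtain C where C: "C \<in> verts H // connectivity H" and K: "K = induced_subgraph H C"
      by (auto simp: components_def)
    have "finite (edges K)"
      using finite_edges by (simp add: K induced_subgraph_def)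
    moreover have "\<exists>u\<in>verts K. \<exists>v\<in>verts K. ends K e = {u, v}" if "e \<in> edges K" for e
      using that edge_ends[of e] by (fastforce simp: K induced_subgraph_def)
    ultimately obtain f :: "nat \<Rightarrow> bool"
      where f: "\<And>e u v. e \<in> edges K \<Longrightarrow> ends K e = {u, v} \<Longrightarrow> f u \<noteq> f v"
      using two_coloring_exists[of "edges K" K] no_odd by (auto 0 0) metis
    \<comment> \<open>A loop at \<open>u\<close> has ends \<open>{u, u}\<close>, which would force
      \<open>f u \<noteq> f u\<close>.\<close>
    have "\<not> contains_loop K"
      using f unfolding contains_loop_def by (metis insert_absorb2)
    moreover have "(if f u then c else - c) + (if f v then c else - c) = 0"
      if "e \<in> edges H" "ends H e = {u, v}" "u \<in> C" "v \<in> C" for e u v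
      using f[of e u v] that by (auto simp: K induced_subgraph_def)
    moreover have "(if f v then c else - c) \<noteq> 0" for v
      using assms(2) by simp
    ultimately show False
      using not_decodable_if_component_solution[OF C, of "\<lambda>v. if f v then c else - c"] dec K
      by blast
  qed
next
  assume "\<forall>K\<in>components H. contains_odd_cycle K"
  then show "decodable TYPE('p) cs H"
    using zero_on_odd_cycle[OF assms(1)] decodable_if_zero_in_components by blast
qed

end

section \<open>Parity of the field order\<close>

lemma of_nat_card_eq_0: "of_nat CARD('a) = (0 :: 'a::{ring_1,finite})"
  by (simp add: of_nat_eq_0_iff_char_dvd CHAR_dvd_CARD)

text \<open>The order of the field is 0 in the field. If it is odd and 2 = 0, this reads 1 = 0; if
  it is even, it is a power of 2, and a field has no nonzero nilpotents.\<close>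

lemma two_eq_0_iff_even_card:
  assumes "primepow CARD('a::{field,finite})"
  shows "(2 :: 'a) = 0 \<longleftrightarrow> even CARD('a)"
proof
  assume two: "(2 :: 'a) = 0"
  show "even CARD('a)"
  proof (rule ccontr)
    assume "odd CARD('a)"
    then obtain m where "CARD('a) = 2 * m + 1"
      by (elim oddE)
    then have "(of_nat CARD('a) :: 'a) = 1"
      using two by simp
    then show False
      by (simp add: of_nat_card_eq_0)
  qed
next
  assume ev: "even CARD('a)"
  obtain p k where p: "prime p" "CARD('a) = p ^ k"
    using assms by (auto simp: primepow_def)
  then have "2 dvd p"
    using ev by (simp add: even_power)
  then have "p = 2"
    using p(1) two_is_prime_nat primes_dvd_imp_eq by blast
  then have "(2 :: 'a) ^ k = 0"
    using of_nat_card_eq_0[where 'a = 'a] p(2) by simp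
  then show "(2 :: 'a) = 0"
    by simp
qed

theorem theorem3:
  fixes q n :: nat
    and cs :: "encoding list"
    and G H :: "(nat, nat) multigraph"
  assumes "primepow q"
    and "CARD('a::{field,finite}) = q"
    and "n \<ge> 2"
    and "coding_scheme n cs"
    and "G = graph_representation n cs"
    and "spanning_subgraph H G"
  shows "decodable TYPE('a ^ 'l::finite) cs H \<longleftrightarrow>
    (let case1 = (even q \<and> (\<forall>K\<in>components H. contains_loop K));
         case2 = (odd q \<and> (\<forall>K\<in>components H. contains_odd_cycle K))
     in (case1 \<or> case2) \<and> \<not> (case1 \<and> case2))"
proof -
  interpret coding_subgraph n cs H
    using assms by unfold_locales simp_all
  have two: "(2 :: 'a) = 0 \<longleftrightarrow> even q"
    using two_eq_0_iff_even_card[where 'a = 'a] assms(1,2) by simp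
  \<comment> \<open>The index type \<open>'l\<close> is inhabited, so a packet has at least one
    coordinate.\<close>
  have nonzero: "(vec 1 :: 'a ^ 'l) \<noteq> 0"
    by (simp add: vec_eq_iff)
  have double: "x + x = (\<chi> i. 2 * x $ i)" for x :: "'a ^ 'l"
    by (simp add: vec_eq_iff)
  show ?thesis
  \<comment> \<open>The parity of \<open>q\<close> makes one of the two cases false, so the
    exclusive disjunction reduces to the other.\<close>
  proof (cases "even q")
    case True
    then have "x + x = 0" for x :: "'a ^ 'l"
      using two by (simp add: double vec_eq_iff)
    then show ?thesis
      using True decodable_iff_loops[where 'p = "'a ^ 'l", OF _ nonzero] by (simp add: Let_def)
  next
    case False
    then have "x = 0" if "x + x = 0" for x :: "'a ^ 'l"
      using that two by (simp add: double vec_eq_iff)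
    then show ?thesis
      using False decodable_iff_odd_cycles[where 'p = "'a ^ 'l", OF _ nonzero] by (simp add: Let_def)
  qed
qed

end
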